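(* Let $d\ge 1$. For all sufficiently large positive integers $m$ there exists $\beta$ with $0<\beta<1/2$ such that $\Theta^\beta\subset\mathsf{A}_m$, where $\mathsf{A}_m$ is the asymptotic shape of the frog model on $\mathbb{Z}^d$ with exactly $m$ particles initially at every site.
   Context: Frog model with $m$ particles per site. At time $0$ every site $x\in\mathbb{Z}^d$ contains exactly $m$ particles; all particles are sleeping except those at the origin, which are active. Active particles perform independent discrete-time simple random walks on $\mathbb{Z}^d$ (each step uniform among the $2d$ nearest neighbours) and do not interact; when an active particle jumps onto a site containing sleeping particles, all of these become active and start their own independent simple random walks. Formally, let $\{S^{x,i} : x\in\mathbb{Z}^d, 1\le i\le m\}$ be independent simple random walks with $S^{x,i}_0=x$ (the trajectory of the $i$-th particle of $x$ counted from its waking time), let $t(x,z)=\min\{n\ge0 : S^{x,i}_n=z\text{ for some } 1\le i\le m\}$ (with $\min\emptyset=\infty$), let $T(x,z)=\inf\{\sum_{j=1}^k t(x_{j-1},x_j) : x_0=x,\dots,x_k=z\text{ for some }k\}$, let $\xi_n=\{y\in\mathbb{Z}^d : T(0,y)\le n\}$ be the set of sites whose particles have been awakened by time $n$, and let $\bar\xi_n=\bigcup_{x\in\xi_n}(x+(-1/2,1/2]^d)\subset\mathbb{R}^d$. Asymptotic shape. $\mathsf{A}_m$ denotes the (deterministic) compact convex set such that for any $0<\varepsilon<1$, almost surely, $(1-\varepsilon)\mathsf{A}_m\subset \bar\xi_n/n\subset(1+\varepsilon)\mathsf{A}_m$ for all $n$ large enough. Such a set exists for every $m\ge1$ and this property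 determines it uniquely among compact convex sets. The sets $\Theta^\beta$. For $1\le i<j\le d$ let $$\Lambda_{ij}=\{x=(x^{(1)},\dots,x^{(d)})\in\mathbb{R}^d : x^{(k)}=0\text{ for } k\ne i,j\},$$ and for $0<\beta<1/2$ let $$\Theta^\beta_{ij}=\{x\in\Lambda_{ij} : |x^{(i)}|+|x^{(j)}|=1,\ \min\{|x^{(i)}|,|x^{(j)}|\}\ge\beta\}.$$ $\Theta^\beta$ is the convex hull of $\bigcup_{1\le i<j\le d}\Theta^\beta_{ij}$ (empty if $d=1$). *)

theory Defs
  imports "HOL-Probability.Probability"
begin

text \<open>The lattice is \<open>int ^ 'd\<close>, so the dimension is \<open>CARD('d)\<close>, an arbitrary positive integer.\<close>

definition unit_steps :: "(int ^ 'd) set" where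
  "unit_steps = (\<Union>k. {axis k 1, - axis k 1})"

lemma finite_unit_steps: "finite (unit_steps :: (int ^ 'd) set)"
  by (simp add: unit_steps_def)

lemma card_unit_steps: "card (unit_steps :: (int ^ 'd) set) = 2 * CARD('d)"
proof -
  have ax: "axis k (1::int) \<noteq> - axis l 1" for k l :: 'd
  proof
    assume "axis k (1::int) = - axis l 1"
    then have "axis k (1::int) $ k = (- axis l 1) $ k" by simp
    then show False by (simp add: axis_def split: if_splits)
  qed
  have "card (unit_steps :: (int ^ 'd) set) = (\<Sum>k\<in>(UNIV :: 'd set). card {axis k (1::int), - axis k 1})"
    unfolding unit_steps_def
  proof (rule card_UN_disjoint)
    show "\<forall>i\<in>(UNIV :: 'd set). \<forall>j\<in>UNIV. i \<noteq> j \<longrightarrow>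
      {axis i (1::int), - axis i 1} \<inter> {axis j 1, - axis j 1} = {}"
      using ax ax[symmetric] by (auto simp: axis_eq_axis)
  qed auto
  also have "\<dots> = 2 * CARD('d)"
    using ax by simp
  finally show ?thesis .
qed

definition simple_random_walk ::
  "'w measure \<Rightarrow> int ^ 'd \<Rightarrow> (nat \<Rightarrow> 'w \<Rightarrow> int ^ 'd) \<Rightarrow> bool" where
  "simple_random_walk M x X \<longleftrightarrow>
     (\<forall>\<omega>\<in>space M. X 0 \<omega> = x) \<and>
     prob_space.indep_vars M (\<lambda>_. count_space UNIV) (\<lambda>n \<omega>. X (Suc n) \<omega> - X n \<omega>) UNIV \<and>
     (\<forall>n. distr M (count_space UNIV) (\<lambda>\<omega>. X (Suc n) \<omega> - X n \<omega>)
            = measure_pmf (pmf_of_set unit_steps))"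

text \<open>\<open>S x i n \<omega>\<close> is the position of the \<open>i\<close>-th particle of \<open>x\<close> at \<open>n\<close> steps after its waking time.
  Independence is that of whole trajectories, as random elements of the product space
  \<open>nat \<Rightarrow> int ^ 'd\<close>.\<close>

definition frog_walks ::
  "nat \<Rightarrow> 'w measure \<Rightarrow> (int ^ 'd \<Rightarrow> nat \<Rightarrow> nat \<Rightarrow> 'w \<Rightarrow> int ^ 'd) \<Rightarrow> bool" where
  "frog_walks m M S \<longleftrightarrow>
     prob_space M \<and>
     (\<forall>x. \<forall>i\<in>{1..m}. simple_random_walk M x (S x i)) \<and>
     prob_space.indep_vars M (\<lambda>_. \<Pi>\<^sub>M n\<in>UNIV. count_space UNIV)
       (\<lambda>(x, i) \<omega> n. S x i n \<omega>) (UNIV \<times> {1..m})"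

text \<open>In \<open>enat\<close> the infimum of the empty set is \<open>\<infinity>\<close>, and a nonempty set attains its infimum.\<close>

definition hit_time ::
  "nat \<Rightarrow> (int ^ 'd \<Rightarrow> nat \<Rightarrow> nat \<Rightarrow> 'w \<Rightarrow> int ^ 'd) \<Rightarrow> 'w \<Rightarrow> int ^ 'd \<Rightarrow> int ^ 'd \<Rightarrow> enat" where
  "hit_time m S \<omega> x z = Inf {enat n | n. \<exists>i\<in>{1..m}. S x i n \<omega> = z}"

definition passage_time ::
  "nat \<Rightarrow> (int ^ 'd \<Rightarrow> nat \<Rightarrow> nat \<Rightarrow> 'w \<Rightarrow> int ^ 'd) \<Rightarrow> 'w \<Rightarrow> int ^ 'd \<Rightarrow> int ^ 'd \<Rightarrow> enat" where
  "passage_time m S \<omega> x z =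
     Inf {\<Sum>j=1..k. hit_time m S \<omega> (p (j - 1)) (p j) | (k :: nat) p. p 0 = x \<and> p k = z}"

definition awakened ::
  "nat \<Rightarrow> (int ^ 'd \<Rightarrow> nat \<Rightarrow> nat \<Rightarrow> 'w \<Rightarrow> int ^ 'd) \<Rightarrow> 'w \<Rightarrow> nat \<Rightarrow> (int ^ 'd) set" where
  "awakened m S \<omega> n = {y. passage_time m S \<omega> 0 y \<le> enat n}"

definition unit_cell :: "int ^ 'd \<Rightarrow> (real ^ 'd) set" where
  "unit_cell x = {y. \<forall>k. y $ k - real_of_int (x $ k) \<in> {-1/2 <.. 1/2}}"

definition awakened_region ::
  "nat \<Rightarrow> (int ^ 'd \<Rightarrow> nat \<Rightarrow> nat \<Rightarrow> 'w \<Rightarrow> int ^ 'd) \<Rightarrow> 'w \<Rightarrow> nat \<Rightarrow> (real ^ 'd) set" where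
  "awakened_region m S \<omega> n = (\<Union>x\<in>awakened m S \<omega> n. unit_cell x)"

definition asymptotic_shape ::
  "nat \<Rightarrow> 'w measure \<Rightarrow> (int ^ 'd \<Rightarrow> nat \<Rightarrow> nat \<Rightarrow> 'w \<Rightarrow> int ^ 'd) \<Rightarrow> (real ^ 'd) set \<Rightarrow> bool" where
  "asymptotic_shape m M S A \<longleftrightarrow>
     compact A \<and> convex A \<and>
     (\<forall>\<epsilon>::real. 0 < \<epsilon> \<and> \<epsilon> < 1 \<longrightarrow>
        (AE \<omega> in M. \<forall>\<^sub>F n in sequentially.
           (\<lambda>y. (1 - \<epsilon>) *\<^sub>R y) ` A \<subseteq> (\<lambda>y. y /\<^sub>R real n) ` awakened_region m S \<omega> n \<and>
           (\<lambda>y. y /\<^sub>R real n) ` awakened_region m S \<omega> n \<subseteq> (\<lambda>y. (1 + \<epsilon>) *\<^sub>R y) ` A))"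

definition coord_plane :: "'d \<Rightarrow> 'd \<Rightarrow> (real ^ 'd) set" where
  "coord_plane i j = {x. \<forall>k. k \<noteq> i \<and> k \<noteq> j \<longrightarrow> x $ k = 0}"

definition Theta_plane :: "real \<Rightarrow> 'd \<Rightarrow> 'd \<Rightarrow> (real ^ 'd) set" where
  "Theta_plane \<beta> i j =
     {x \<in> coord_plane i j. \<bar>x $ i\<bar> + \<bar>x $ j\<bar> = 1 \<and> min \<bar>x $ i\<bar> \<bar>x $ j\<bar> \<ge> \<beta>}"

lemma Theta_plane_commute: "Theta_plane \<beta> i j = Theta_plane \<beta> j i"
  by (auto simp: Theta_plane_def coord_plane_def)

text \<open>The index type carries no order; since \<open>Theta_plane \<beta> i j\<close> is symmetric in \<open>i\<close> and \<open>j\<close>,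
  the union over pairs \<open>i < j\<close> is the union over pairs \<open>i \<noteq> j\<close>.\<close>

definition Theta :: "real \<Rightarrow> (real ^ 'd) set" where
  "Theta \<beta> = convex hull (\<Union>(i, j)\<in>{(i, j). i \<noteq> j}. Theta_plane \<beta> i j)"

end

(* Only first steps matter.  Call a site closed if the first steps of its particles miss at least
   one of two chosen directions u, v in the plane of coordinates i, j; sites are independently closed with
   probability at most 2 (1 - 1/(2d))^m.  A path of open sites with steps u and v wakes up one new
   site per unit of time.  Writing (x, h) for the site reached by x - h steps u and h steps v, such a
   path is found as a Lipschitz interface (as in Lipschitz percolation) just above the set of blocked
   points, which are reached from the region 4 h < x by free moves (1, 0) and (-1, -1) and by moves
   (0, 1) onto closed sites.  The free moves lower 4 h - x and an upward move raises it by only 4, so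
   at least one fifth of the moves of a blocking walk land on distinct closed sites, and counting
   walks shows that a point with 4 h >= x is unblocked with probability at least 3/4.  Hence
   with probability at least 1/2 the origin and (3 k, k) are both unblocked, and then a site (3 k, h)
   with 0 <= h <= k is awake at time 3 k.  In the limit the shape contains a point
   (1 - b) u + b v with b <= 1/3; exchanging u and v and using convexity gives beta = 1/3. *)

theory Submission
  imports Defs "HOL-Library.Transitive_Closure_Table" "HOL-Real_Asymp.Real_Asymp"
begin

section \<open>Blocked points and the interface above them\<close>

text \<open>Moves are reversed, so that the blocking walks are counted from their
  fixed end point.\<close>

definition back_step :: "(int \<times> int \<Rightarrow> bool) \<Rightarrow> int \<times> int \<Rightarrow> int \<times> int \<Rightarrow> bool" where
  "back_step C = (\<lambda>(x, h) z. C (x, h) \<and> z = (x, h - 1) \<or> z = (x - 1, h) \<or> z = (x + 1, h + 1))"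

text \<open>The seed region lies below a line of slope 1/4: this is less than the slope 1/3 of the
  points \<open>(3 k, k)\<close> used later, and \<open>4 * h - x\<close> decreases along both free
  moves.\<close>

definition blocked :: "(int \<times> int \<Rightarrow> bool) \<Rightarrow> int \<times> int \<Rightarrow> bool" where
  "blocked C z \<longleftrightarrow> (\<exists>x h. (back_step C)\<^sup>*\<^sup>* z (x, h) \<and> 4 * h < x)"

lemma blocked_start: "4 * h < x \<Longrightarrow> blocked C (x, h)"
  unfolding blocked_def by blast

lemma blocked_back_step: "back_step C z z' \<Longrightarrow> blocked C z' \<Longrightarrow> blocked C z"
  unfolding blocked_def by (meson converse_rtranclp_into_rtranclp)

lemma blocked_right: "blocked C (x, h) \<Longrightarrow> blocked C (x + 1, h)"
  by (rule blocked_back_step[of _ _ "(x, h)"]) (auto simp: back_step_def)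

lemma blocked_left: "blocked C (x + 1, h + 1) \<Longrightarrow> blocked C (x, h)"
  by (rule blocked_back_step[of _ _ "(x + 1, h + 1)"]) (auto simp: back_step_def)

lemma blocked_up: "C (x, h) \<Longrightarrow> blocked C (x, h - 1) \<Longrightarrow> blocked C (x, h)"
  by (rule blocked_back_step[of _ _ "(x, h - 1)"]) (auto simp: back_step_def)

text \<open>The two free moves compose to a step straight down, so the blocked part of each column
  is closed downwards, whatever \<open>C\<close> is.\<close>

lemma blocked_down: "blocked C (x, h) \<Longrightarrow> blocked C (x, h - 1)"
  using blocked_left[of C x "h - 1"] blocked_right[of C x h] by simp

lemma blocked_antimono:
  assumes "blocked C (x, h)" "h' \<le> h"
  shows "blocked C (x, h')"
  using assms(2,1) by (induction h' rule: int_le_induct) (auto intro: blocked_down)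

text \<open>The path runs along the lowest unblocked points of the columns. Free moves to the right
  keep it from descending, and free moves to the lower left keep it from rising by more than 1. A
  closed site on it would be blocked by an upward move from the blocked point just below.\<close>

lemma open_path:
  assumes "\<not> blocked C (0, 0)"
  obtains g :: "nat \<Rightarrow> int" where "g 0 = 0" "\<And>n. g (Suc n) = g n \<or> g (Suc n) = g n + 1"
    "\<And>n. \<not> C (int n, g n)" "\<And>n. blocked C (int n, g n - 1)"
proof -
  let ?P = "\<lambda>n h. (n = 0 \<longrightarrow> h = 0) \<and> \<not> blocked C (int n, h) \<and> blocked C (int n, h - 1)"
  let ?Q = "\<lambda>h h'. h' = h \<or> h' = h + (1::int)"
  have "\<exists>g. \<forall>n. ?P n (g n) \<and> ?Q (g n) (g (Suc n))"
  proof (rule dependent_nat_choice[where P = ?P and Q = "\<lambda>_. ?Q"])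
    \<comment> \<open>The point \<open>(0, -1)\<close> lies in the seed region, so the interface
      starts exactly at height 0.\<close>
    show "\<exists>h. ?P 0 h"
      using assms by (auto intro!: exI[of _ 0] blocked_start)
    fix h n assume *: "?P n h"
    have 1: "blocked C (int (Suc n), h - 1)"
      using * blocked_right[of C "int n" "h - 1"] by (simp add: add.commute)
    have 2: "\<not> blocked C (int (Suc n), h + 1)"
      using * blocked_left[of C "int n" h] by (auto simp: add.commute)
    show "\<exists>h'. ?P (Suc n) h' \<and> ?Q h h'"
    proof (cases "blocked C (int (Suc n), h)")
      case True
      with 2 show ?thesis by (intro exI[of _ "h + 1"]) auto
    next
      case False
      with 1 show ?thesis by (intro exI[of _ h]) auto
    qed
  qed
  then obtain g where g: "\<And>n. ?P n (g n)" "\<And>n. ?Q (g n) (g (Suc n))"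
    by blast
  show ?thesis
    by (rule that[of g]) (use g blocked_up in blast)+
qed

section \<open>Counting blocking walks and their upward moves\<close>

fun back_walks :: "int \<times> int \<Rightarrow> nat \<Rightarrow> (int \<times> int) list set" where
  "back_walks z 0 = {[]}"
| "back_walks (x, h) (Suc L) =
     (\<Union>z'\<in>{(x, h - 1), (x - 1, h), (x + 1, h + 1)}. (#) z' ` back_walks z' L)"

text \<open>Read in the original direction, these are the points on which an upward move
  lands.\<close>

fun ups :: "int \<times> int \<Rightarrow> (int \<times> int) list \<Rightarrow> (int \<times> int) set" where
  "ups z [] = {}"
| "ups (x, h) (z' # zs) = (if z' = (x, h - 1) then {(x, h)} else {}) \<union> ups z' zs"

lemma finite_back_walks: "finite (back_walks z L)"
  by (induction z L rule: back_walks.induct) auto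

lemma card_back_walks: "card (back_walks z L) \<le> 3 ^ L"
proof (induction z L rule: back_walks.induct)
  case (2 x h L)
  let ?N = "{(x, h - 1), (x - 1, h), (x + 1, h + 1)}"
  have "card (back_walks (x, h) (Suc L)) \<le> (\<Sum>z'\<in>?N. card ((#) z' ` back_walks z' L))"
    unfolding back_walks.simps by (rule card_UN_le) simp
  also have "\<dots> \<le> (\<Sum>z'\<in>?N. 3 ^ L)"
    by (intro sum_mono order_trans[OF card_image_le 2] finite_back_walks)
  also have "\<dots> = 3 ^ Suc L" by simp
  finally show ?case .
qed simp

lemma ups_subset: "ups z zs \<subseteq> set (z # zs)"
  by (induction z zs rule: ups.induct) auto

lemma finite_ups: "finite (ups z zs)"
  by (rule finite_subset[OF ups_subset]) simp

text \<open>Along the reversed walk \<open>4 * h - x\<close> drops by \<open>4\<close> at an upward move and otherwise grows by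
  at least \<open>1\<close>.\<close>

lemma card_ups:
  assumes "zs \<in> back_walks (x, h) L" "distinct ((x, h) # zs)" "last ((x, h) # zs) = (x', h')"
  shows "4 * h - x + int L \<le> 4 * h' - x' + 5 * int (card (ups (x, h) zs))"
  using assms
proof (induction L arbitrary: x h zs)
  case (Suc L)
  then obtain x1 h1 zs' where zs: "zs = (x1, h1) # zs'" "zs' \<in> back_walks (x1, h1) L"
    "(x1, h1) \<in> {(x, h - 1), (x - 1, h), (x + 1, h + 1)}"
    by auto
  have IH: "4 * h1 - x1 + int L \<le> 4 * h' - x' + 5 * int (card (ups (x1, h1) zs'))"
    using Suc.prems zs by (intro Suc.IH) auto
  \<comment> \<open>Distinctness keeps the current point from recurring later, so an upward move
    contributes a new element and not a repeated one.\<close>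
  have "(x, h) \<notin> ups (x1, h1) zs'"
    using Suc.prems(2) ups_subset[of "(x1, h1)" zs'] unfolding zs(1) by auto
  then have "card (ups (x, h) zs) = (if (x1, h1) = (x, h - 1) then 1 else 0) + card (ups (x1, h1) zs')"
    by (auto simp: zs(1) finite_ups)
  with IH zs(3) show ?case by (auto split: if_splits)
qed simp

text \<open>A move from \<open>(x, h)\<close> to \<open>(x, h - 1)\<close> is never a free one, so
  it must come from the alternative of \<open>back_step\<close> that demands
  \<open>C (x, h)\<close>.\<close>

lemma rtrancl_path_back_walk:
  assumes "rtrancl_path (back_step C) z zs s"
  shows "zs \<in> back_walks z (length zs) \<and> ups z zs \<subseteq> Collect C \<and> last (z # zs) = s"
  using assms
proof (induction rule: rtrancl_path.induct)
  case (step z z' zs s)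
  then show ?case
    by (cases z) (auto simp: back_step_def)
qed simp

text \<open>The potential \<open>4 * h - x\<close> is nonnegative at the given point and negative at
  the seed, so the balance of \<open>card_ups\<close> leaves at most 5 moves per closed
  site.\<close>

lemma blocked_walk:
  assumes "blocked C (x, h)" "4 * h \<ge> x"
  obtains L zs where "L > 0" "zs \<in> back_walks (x, h) L" "ups (x, h) zs \<subseteq> Collect C"
    "L \<le> 5 * card (ups (x, h) zs)"
proof -
  from assms(1) obtain x' h' where "(back_step C)\<^sup>*\<^sup>* (x, h) (x', h')" and neg: "4 * h' < x'"
    unfolding blocked_def by blast
  then obtain ys where "rtrancl_path (back_step C) (x, h) ys (x', h')"
    by (auto simp: rtranclp_eq_rtrancl_path)
  \<comment> \<open>Erasing loops makes the upward moves land on distinct sites.\<close>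
  then obtain zs where zs: "rtrancl_path (back_step C) (x, h) zs (x', h')" "distinct ((x, h) # zs)"
    by (rule rtrancl_path_distinct)
  note w = rtrancl_path_back_walk[OF zs(1)]
  have "4 * h - x + int (length zs) \<le> 4 * h' - x' + 5 * int (card (ups (x, h) zs))"
    using w zs(2) by (intro card_ups) auto
  moreover have "zs \<noteq> []"
    using w neg assms(2) by auto
  ultimately show ?thesis
    using w neg assms(2) by (intro that[of "length zs" zs]) auto
qed

section \<open>Probability that a point is blocked\<close>

text \<open>Peierls argument: there are at most \<open>3 ^ n\<close> walks of length
  \<open>n\<close>, and each needs at least \<open>n / 5\<close> distinct closed sites, which has
  probability at most \<open>(1 / 15) ^ n\<close>. Summing \<open>(1 / 5) ^ n\<close> over positive
  \<open>n\<close> gives 1/4.\<close>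

lemma (in prob_space) prob_blocked:
  fixes E :: "int \<times> int \<Rightarrow> 'a set" and q :: real
  assumes E [measurable]: "\<And>y. E y \<in> events"
    and prob: "\<And>Y. finite Y \<Longrightarrow> prob {\<omega>\<in>space M. \<forall>y\<in>Y. \<omega> \<in> E y} \<le> q ^ card Y"
    and q: "0 \<le> q" "q \<le> (1 / 15) ^ 5" and z: "4 * h \<ge> x"
  obtains B where "B \<in> events" "prob B \<le> 1 / 4"
    "\<And>\<omega>. \<omega> \<in> space M - B \<Longrightarrow> \<not> blocked (\<lambda>y. \<omega> \<in> E y) (x, h)"
proof -
  \<comment> \<open>Lengths are shifted to \<open>Suc L\<close>, since a blocking walk is nonempty;
    a term for length 0 would already spoil the bound.\<close>
  define W where "W L = {zs \<in> back_walks (x, h) (Suc L). Suc L \<le> 5 * card (ups (x, h) zs)}" for L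
  define F where "F zs = {\<omega>\<in>space M. \<forall>y\<in>ups (x, h) zs. \<omega> \<in> E y}" for zs
  define B where "B = (\<Union>L. \<Union>zs\<in>W L. F zs)"
  have finW: "finite (W L)" for L
    unfolding W_def using finite_back_walks by auto
  have F: "F zs \<in> events" for zs
    unfolding F_def by (intro sets.sets_Collect_finite_All finite_ups) simp
  have cardW: "card (W L) \<le> 3 ^ Suc L" for L
    unfolding W_def by (rule order_trans[OF card_mono[OF finite_back_walks] card_back_walks]) (auto simp del: back_walks.simps)
  have probF: "prob (F zs) \<le> (1 / 15) ^ Suc L" if "zs \<in> W L" for zs L
  proof -
    have "prob (F zs) \<le> q ^ card (ups (x, h) zs)"
      unfolding F_def by (intro prob finite_ups)
    also have "\<dots> \<le> ((1 / 15) ^ 5) ^ card (ups (x, h) zs)"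
      using q by (intro power_mono)
    also have "\<dots> = (1 / 15) ^ (5 * card (ups (x, h) zs))"
      by (simp only: power_mult)
    also have "\<dots> \<le> (1 / 15) ^ Suc L"
      using that by (intro power_decreasing) (auto simp: W_def)
    finally show ?thesis .
  qed
  have level: "prob (\<Union>zs\<in>W L. F zs) \<le> (1 / 5) ^ Suc L" for L
  proof -
    have "prob (\<Union>zs\<in>W L. F zs) \<le> (\<Sum>zs\<in>W L. prob (F zs))"
      using F finW by (intro finite_measure_subadditive_finite) auto
    also have "\<dots> \<le> real (card (W L)) * (1 / 15) ^ Suc L"
      using sum_bounded_above[of "W L" "\<lambda>zs. prob (F zs)", OF probF] by simp
    also have "\<dots> \<le> 3 ^ Suc L * (1 / 15) ^ Suc L"
      using cardW[of L] by (intro mult_right_mono) (simp_all del: power_Suc)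
    also have "\<dots> = (1 / 5) ^ Suc L"
      by (simp only: flip: power_mult_distrib) simp
    finally show ?thesis .
  qed
  have s: "(\<lambda>L. (1 / 5 :: real) ^ Suc L) sums (1 / 4)"
    using sums_mult[OF geometric_sums[of "1 / 5 :: real"], of "1 / 5"] by simp
  have summ: "summable (\<lambda>L. prob (\<Union>zs\<in>W L. F zs))"
    by (rule summable_comparison_test'[OF sums_summable[OF s], of 0]) (use level in auto)
  have "prob B \<le> (\<Sum>L. prob (\<Union>zs\<in>W L. F zs))"
    unfolding B_def using F finW summ by (intro finite_measure_subadditive_countably) auto
  also have "\<dots> \<le> (\<Sum>L. (1 / 5) ^ Suc L)"
    using summ sums_summable[OF s] level by (intro suminf_le) auto
  also have "\<dots> = 1 / 4"
    using s by (rule sums_unique[symmetric])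
  finally have "prob B \<le> 1 / 4" .
  moreover have "B \<in> events"
    unfolding B_def using F finW by (intro sets.countable_UN sets.finite_UN) auto
  moreover have "\<not> blocked (\<lambda>y. \<omega> \<in> E y) (x, h)" if "\<omega> \<in> space M - B" for \<omega>
  proof
    assume "blocked (\<lambda>y. \<omega> \<in> E y) (x, h)"
    then obtain L zs where "L > 0" "zs \<in> back_walks (x, h) L" "ups (x, h) zs \<subseteq> Collect (\<lambda>y. \<omega> \<in> E y)"
      "L \<le> 5 * card (ups (x, h) zs)"
      using z by (rule blocked_walk)
    then have "zs \<in> W (L - 1)" "\<omega> \<in> F zs"
      using that by (auto simp: W_def F_def)
    with that show False by (auto simp: B_def)
  qed
  ultimately show ?thesis using that by blast
qed


section \<open>Recurring events and waking along paths\<close>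

text \<open>The tail unions decrease to the limsup of the events, which by continuity from above has
  probability at least \<open>c\<close>. Being of positive probability, it meets the almost sure
  event.\<close>

lemma (in prob_space) frequently_AE:
  assumes G: "\<And>k. G k \<in> events" "\<And>k. c \<le> prob (G k)" and c: "0 < c"
    and Q: "AE \<omega> in M. \<forall>\<^sub>F k in sequentially. Q \<omega> k"
  obtains k :: nat and \<omega> where "k > 0" "\<omega> \<in> G k" "Q \<omega> k"
proof -
  let ?U = "\<lambda>n. \<Union>k\<in>{n..}. G k"
  have U: "?U n \<in> events" for n
    using G(1) by (intro sets.countable_UN') auto
  have "(\<lambda>n. prob (?U n)) \<longlonglongrightarrow> prob (\<Inter>n. ?U n)"
  proof (rule finite_Lim_measure_decseq)
    show "decseq ?U"
      by (intro decseq_SucI UN_mono) auto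
  qed (use U in auto)
  moreover have "c \<le> prob (?U n)" for n
    using G(2)[of n] U[of n] by (elim order_trans) (intro finite_measure_mono, auto)
  ultimately have "c \<le> prob (\<Inter>n. ?U n)"
    by (intro tendsto_lowerbound[where F = sequentially]) auto
  moreover have "prob (\<Inter>n. ?U n) = 0" if "AE \<omega> in M. \<omega> \<notin> (\<Inter>n. ?U n)"
    using that U by (subst prob_eq_0) auto
  ultimately have "\<not> (AE \<omega> in M. \<omega> \<notin> (\<Inter>n. ?U n))"
    using c by auto
  then obtain \<omega> where \<omega>: "\<omega> \<in> (\<Inter>n. ?U n)" "\<forall>\<^sub>F k in sequentially. Q \<omega> k"
    using Q by (metis (mono_tags, lifting) eventually_mono)
  then obtain N where "\<forall>k\<ge>N. Q \<omega> k"
    by (auto simp: eventually_sequentially)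
  \<comment> \<open>\<open>Suc N\<close> instead of \<open>N\<close> makes \<open>k\<close>
    positive, as the later division by \<open>3 * k\<close> requires.\<close>
  moreover obtain k where "k \<ge> Suc N" "\<omega> \<in> G k"
    using \<omega>(1) by blast
  ultimately show ?thesis
    by (intro that[of k \<omega>]) auto
qed

text \<open>Every edge of the path is realised by the first step of some particle, so its hitting
  time is at most 1 and the sum over the edges is at most \<open>n\<close>.\<close>

lemma awakened_path:
  assumes "p 0 = 0" "\<And>k. k < n \<Longrightarrow> \<exists>i\<in>{1..m}. S (p k) i 1 \<omega> = p (Suc k)"
  shows "p n \<in> awakened m S \<omega> n"
proof -
  have "hit_time m S \<omega> (p (j - 1)) (p j) \<le> 1" if "j \<in> {1..n}" for j
    using assms(2)[of "j - 1"] that unfolding hit_time_def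
    by (intro Inf_lower) (auto simp: one_enat_def)
  then have "(\<Sum>j=1..n. hit_time m S \<omega> (p (j - 1)) (p j)) \<le> (\<Sum>j=1..n. 1)"
    by (rule sum_mono)
  also have "\<dots> = enat n"
    by (simp add: of_nat_eq_enat)
  finally have "passage_time m S \<omega> 0 (p n) \<le> enat n"
    unfolding passage_time_def using assms(1) by (intro Inf_lower2) auto
  then show ?thesis
    by (simp add: awakened_def)
qed

section \<open>Law of the first steps and closed sites\<close>

lemma miss_prob_bounds:
  "1 / 2 \<le> 1 - 1 / (2 * real CARD('d :: finite))" "1 - 1 / (2 * real CARD('d)) < 1"
proof -
  have "1 \<le> real CARD('d)"
    by (simp add: Suc_le_eq)
  then have "1 / (2 * real CARD('d)) \<le> 1 / 2"
    by (intro divide_left_mono) linarith+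
  then show "1 / 2 \<le> 1 - 1 / (2 * real CARD('d))" by linarith
qed simp

lemma frog_walks_first_step_indep:
  fixes S :: "int ^ 'd \<Rightarrow> nat \<Rightarrow> nat \<Rightarrow> 'w \<Rightarrow> int ^ 'd"
  assumes "frog_walks m M S"
  shows "prob_space.indep_vars M (\<lambda>_. count_space UNIV) (\<lambda>(x, i). S x i 1) (UNIV \<times> {1..m})"
proof -
  interpret prob_space M using assms by (simp add: frog_walks_def)
  have "indep_vars (\<lambda>_. \<Pi>\<^sub>M n\<in>UNIV. count_space UNIV) (\<lambda>(x, i) \<omega> n. S x i n \<omega>) (UNIV \<times> {1..m})"
    using assms by (simp add: frog_walks_def)
  then have "indep_vars (\<lambda>_. count_space UNIV) (\<lambda>k \<omega>. (case k of (x, i) \<Rightarrow> \<lambda>\<omega> n. S x i n \<omega>) \<omega> 1) (UNIV \<times> {1..m})"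
    by (rule indep_vars_compose2[where Y = "\<lambda>_ f. f 1"]) simp
  also have "(\<lambda>k \<omega>. (case k of (x, i) \<Rightarrow> \<lambda>\<omega> n. S x i n \<omega>) \<omega> 1) = (\<lambda>(x, i). S x i 1)"
    by auto
  finally show ?thesis .
qed

lemma frog_walks_first_step_prob:
  fixes S :: "int ^ 'd \<Rightarrow> nat \<Rightarrow> nat \<Rightarrow> 'w \<Rightarrow> int ^ 'd"
  assumes "frog_walks m M S" "i \<in> {1..m}" "w \<in> unit_steps"
  shows "measure M {\<omega>\<in>space M. S x i 1 \<omega> \<noteq> x + w} = 1 - 1 / (2 * CARD('d))"
proof -
  interpret prob_space M using assms by (simp add: frog_walks_def)
  let ?X = "\<lambda>\<omega>. S x i 1 \<omega> - S x i 0 \<omega>"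
  have srw: "simple_random_walk M x (S x i)"
    using assms by (auto simp: frog_walks_def)
  have dist: "distr M (count_space UNIV) ?X = measure_pmf (pmf_of_set unit_steps)"
    using srw by (auto simp: simple_random_walk_def)
  have "indep_vars (\<lambda>_. count_space UNIV) (\<lambda>n \<omega>. S x i (Suc n) \<omega> - S x i n \<omega>) UNIV"
    using srw by (auto simp: simple_random_walk_def)
  then have "random_variable (count_space UNIV) (\<lambda>\<omega>. S x i (Suc 0) \<omega> - S x i 0 \<omega>)"
    unfolding indep_vars_def by blast
  then have X: "random_variable (count_space UNIV) ?X"
    by (simp only: One_nat_def)
  have "unit_steps \<noteq> ({} :: (int ^ 'd) set)"
    using assms by auto
  then have "1 / (2 * CARD('d)) = measure (measure_pmf (pmf_of_set unit_steps)) {w}"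
    using assms by (simp add: measure_pmf_single finite_unit_steps card_unit_steps)
  also have "\<dots> = prob (?X -` {w} \<inter> space M)"
    unfolding dist[symmetric] by (rule measure_distr[OF X]) simp
  finally have "prob (?X -` {w} \<inter> space M) = 1 / (2 * CARD('d))" ..
  moreover have "{\<omega>\<in>space M. S x i 1 \<omega> \<noteq> x + w} = space M - (?X -` {w} \<inter> space M)"
    using srw by (auto simp: simple_random_walk_def)
  moreover have "?X -` {w} \<inter> space M \<in> events"
    using X by (rule measurable_sets) auto
  ultimately show ?thesis
    by (simp add: prob_compl)
qed

text \<open>The missed direction \<open>w y\<close> may vary with the site; this serves the union
  bound over all choices of one of two directions per site.\<close>

lemma prob_no_first_step:
  fixes S :: "int ^ 'd \<Rightarrow> nat \<Rightarrow> nat \<Rightarrow> 'w \<Rightarrow> int ^ 'd"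
  assumes "frog_walks m M S" "finite Y" "\<And>y. y \<in> Y \<Longrightarrow> w y \<in> unit_steps"
  shows "measure M {\<omega>\<in>space M. \<forall>y\<in>Y. \<forall>i\<in>{1..m}. S y i 1 \<omega> \<noteq> y + w y}
    = ((1 - 1 / (2 * CARD('d))) ^ m) ^ card Y"
\<comment> \<open>The product rule for independent variables needs a nonempty index set; in the
  degenerate cases both sides are 1.\<close>
proof (cases "Y = {} \<or> m = 0")
  case True
  interpret prob_space M using assms by (simp add: frog_walks_def)
  from True show ?thesis by (auto simp: prob_space)
next
  case False
  interpret prob_space M using assms by (simp add: frog_walks_def)
  let ?J = "Y \<times> {1..m}" and ?X = "\<lambda>(x, i). S x i 1" and ?A = "\<lambda>(y, i). - {y + w y}"
  have "{\<omega>\<in>space M. \<forall>y\<in>Y. \<forall>i\<in>{1..m}. S y i 1 \<omega> \<noteq> y + w y}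
      = (\<Inter>k\<in>?J. ?X k -` ?A k \<inter> space M)"
    using False by (auto simp: Suc_le_eq)
  also have "prob \<dots> = (\<Prod>k\<in>?J. prob (?X k -` ?A k \<inter> space M))"
    using False assms(2) by (intro indep_varsD[OF frog_walks_first_step_indep[OF assms(1)]]) auto
  also have "\<dots> = (\<Prod>k\<in>?J. 1 - 1 / (2 * CARD('d)))"
  proof (rule prod.cong[OF refl])
    fix k assume "k \<in> ?J"
    then obtain y i where k: "k = (y, i)" "y \<in> Y" "i \<in> {1..m}" by auto
    have "?X k -` ?A k \<inter> space M = {\<omega>\<in>space M. S y i 1 \<omega> \<noteq> y + w y}"
      by (auto simp: k)
    then show "prob (?X k -` ?A k \<inter> space M) = 1 - 1 / (2 * CARD('d))"
      using frog_walks_first_step_prob[OF assms(1) k(3) assms(3)[OF k(2)]] by simp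
  qed
  also have "\<dots> = ((1 - 1 / (2 * CARD('d))) ^ m) ^ card Y"
    by (simp add: card_cartesian_product mult.commute flip: power_mult)
  finally show ?thesis .
qed

definition missed :: "nat \<Rightarrow> 'w measure \<Rightarrow> (int ^ 'd \<Rightarrow> nat \<Rightarrow> nat \<Rightarrow> 'w \<Rightarrow> int ^ 'd) \<Rightarrow>
    int ^ 'd \<Rightarrow> int ^ 'd \<Rightarrow> 'w set" where
  "missed m M S w y = {\<omega>\<in>space M. \<forall>i\<in>{1..m}. S y i 1 \<omega> \<noteq> y + w}"

lemma sets_missed:
  fixes S :: "int ^ 'd \<Rightarrow> nat \<Rightarrow> nat \<Rightarrow> 'w \<Rightarrow> int ^ 'd"
  assumes "frog_walks m M S"
  shows "missed m M S w y \<in> sets M"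
proof -
  interpret prob_space M using assms by (simp add: frog_walks_def)
  have X: "random_variable (count_space UNIV) (S y i 1)" if "i \<in> {1..m}" for i
    using frog_walks_first_step_indep[OF assms] that unfolding indep_vars_def by fastforce
  have "{\<omega>\<in>space M. S y i 1 \<omega> \<noteq> y + w} \<in> events" if "i \<in> {1..m}" for i
  proof -
    have "S y i 1 -` (- {y + w}) \<inter> space M \<in> events"
      using X[OF that] by (rule measurable_sets) auto
    also have "S y i 1 -` (- {y + w}) \<inter> space M = {\<omega>\<in>space M. S y i 1 \<omega> \<noteq> y + w}"
      by auto
    finally show ?thesis .
  qed
  then show ?thesis
    unfolding missed_def by (intro sets.sets_Collect_finite_All) auto
qed

text \<open>Each closed site misses \<open>u\<close> or \<open>v\<close>. A union bound over the
  \<open>2 ^ card Y\<close> ways to choose one missed direction per site supplies the factor 2 in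
  the base.\<close>

lemma prob_missed:
  fixes S :: "int ^ 'd \<Rightarrow> nat \<Rightarrow> nat \<Rightarrow> 'w \<Rightarrow> int ^ 'd"
  assumes frog: "frog_walks m M S" and Y: "finite Y" and uv: "u \<in> unit_steps" "v \<in> unit_steps"
  shows "measure M {\<omega>\<in>space M. \<forall>y\<in>Y. \<omega> \<in> missed m M S u y \<union> missed m M S v y}
    \<le> (2 * (1 - 1 / (2 * CARD('d))) ^ m) ^ card Y"
proof -
  interpret prob_space M using frog by (simp add: frog_walks_def)
  \<comment> \<open>\<open>V\<close> is the set of sites at which the chosen missed direction is
    \<open>u\<close>.\<close>
  let ?w = "\<lambda>V y. if y \<in> V then u else v"
  let ?F = "\<lambda>V. {\<omega>\<in>space M. \<forall>y\<in>Y. \<omega> \<in> missed m M S (?w V y) y}"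
  have F: "?F V \<in> events" for V
    using Y sets_missed[OF frog, measurable] by (intro sets.sets_Collect_finite_All) auto
  have "{\<omega>\<in>space M. \<forall>y\<in>Y. \<omega> \<in> missed m M S u y \<union> missed m M S v y} \<subseteq> (\<Union>V\<in>Pow Y. ?F V)"
  proof
    fix \<omega> assume "\<omega> \<in> {\<omega>\<in>space M. \<forall>y\<in>Y. \<omega> \<in> missed m M S u y \<union> missed m M S v y}"
    then have "\<omega> \<in> ?F {y\<in>Y. \<omega> \<in> missed m M S u y}" by auto
    then show "\<omega> \<in> (\<Union>V\<in>Pow Y. ?F V)" by (rule UN_I[rotated]) simp
  qed
  then have "prob {\<omega>\<in>space M. \<forall>y\<in>Y. \<omega> \<in> missed m M S u y \<union> missed m M S v y} \<le> prob (\<Union>V\<in>Pow Y. ?F V)"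
    using Y F by (intro finite_measure_mono sets.finite_UN) auto
  also have "\<dots> \<le> (\<Sum>V\<in>Pow Y. prob (?F V))"
    using Y by (intro finite_measure_subadditive_finite image_subsetI F) simp
  also have "\<dots> = (\<Sum>V\<in>Pow Y. ((1 - 1 / (2 * CARD('d))) ^ m) ^ card Y)"
  proof (rule sum.cong[OF refl])
    fix V
    have "?F V = {\<omega>\<in>space M. \<forall>y\<in>Y. \<forall>i\<in>{1..m}. S y i 1 \<omega> \<noteq> y + ?w V y}"
      by (auto simp: missed_def)
    then show "prob (?F V) = ((1 - 1 / (2 * CARD('d))) ^ m) ^ card Y"
      using prob_no_first_step[OF frog Y, of "?w V"] uv by simp
  qed
  also have "\<dots> = (2 * (1 - 1 / (2 * CARD('d))) ^ m) ^ card Y"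
    using Y by (simp add: card_Pow power_mult_distrib)
  finally show ?thesis .
qed

section \<open>Awake sites in a coordinate plane\<close>

text \<open>The signs \<open>s\<close> and \<open>t\<close> select one of the four quadrants of the
  plane. Each step of an open path raises \<open>x\<close> by 1, so \<open>x\<close> is the elapsed
  time.\<close>

definition site :: "'d \<Rightarrow> 'd \<Rightarrow> int \<Rightarrow> int \<Rightarrow> int \<times> int \<Rightarrow> int ^ 'd" where
  "site i j s t = (\<lambda>(x, h). axis i (s * (x - h)) + axis j (t * h))"

lemma site_nth:
  assumes "i \<noteq> j"
  shows "site i j s t (x, h) $ k = (if k = i then s * (x - h) else if k = j then t * h else 0)"
  using assms by (simp add: site_def axis_def)

lemma inj_site:
  assumes "i \<noteq> j" "s \<noteq> 0" "t \<noteq> 0"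
  shows "inj (site i j s t)"
proof (rule injI)
  fix z z' assume eq: "site i j s t z = site i j s t z'"
  obtain x h x' h' where z: "z = (x, h)" "z' = (x', h')" by fastforce
  have "site i j s t (x, h) $ i = site i j s t (x', h') $ i"
    "site i j s t (x, h) $ j = site i j s t (x', h') $ j"
    using eq z by auto
  with assms show "z = z'" by (auto simp: site_nth z)
qed

lemma prob_awakened_site:
  fixes S :: "int ^ 'd \<Rightarrow> nat \<Rightarrow> nat \<Rightarrow> 'w \<Rightarrow> int ^ 'd"
  assumes frog: "frog_walks m M S" and m: "2 * (1 - 1 / (2 * real CARD('d))) ^ m \<le> (1 / 15) ^ 5"
    and ij: "i \<noteq> j" and st: "s \<in> {1, -1}" "t \<in> {1, -1}"
  obtains G where "G \<in> sets M" "1 / 2 \<le> measure M G"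
    "\<And>\<omega>. \<omega> \<in> G \<Longrightarrow> \<exists>h. 0 \<le> h \<and> h \<le> int k \<and> site i j s t (3 * int k, h) \<in> awakened m S \<omega> (3 * k)"
proof -
  interpret prob_space M using frog by (simp add: frog_walks_def)
  define u v :: "int ^ 'd" where "u = axis i s" and "v = axis j t"
  have uv: "u \<in> unit_steps" "v \<in> unit_steps"
    using st by (auto simp: u_def v_def unit_steps_def axis_def vec_eq_iff)
  let ?q = "2 * (1 - 1 / (2 * real CARD('d))) ^ m"
  let ?s = "site i j s t"
  define E where "E z = missed m M S u (?s z) \<union> missed m M S v (?s z)" for z
  have E: "E z \<in> events" for z
    unfolding E_def by (intro sets.Un sets_missed[OF frog])
  have inj: "inj_on ?s Y" for Y
    using inj_site[OF ij, of s t] st by (auto intro: inj_on_subset)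
  \<comment> \<open>Injectivity of \<open>site\<close> keeps the exponent equal to the number of
    plane points.\<close>
  have probE: "prob {\<omega>\<in>space M. \<forall>z\<in>Y. \<omega> \<in> E z} \<le> ?q ^ card Y" if "finite Y" for Y
    using prob_missed[OF frog _ uv, of "?s ` Y"] that by (simp add: E_def card_image[OF inj])
  have q: "0 \<le> ?q"
    using miss_prob_bounds[where 'd = 'd] by (intro mult_nonneg_nonneg zero_le_power) linarith+
  obtain B0 where B0: "B0 \<in> events" "prob B0 \<le> 1 / 4"
    "\<And>\<omega>. \<omega> \<in> space M - B0 \<Longrightarrow> \<not> blocked (\<lambda>y. \<omega> \<in> E y) (0, 0)"
    by (rule prob_blocked[OF E probE q m, of 0 0]) auto
  \<comment> \<open>The point \<open>(3 k, k)\<close> qualifies because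
    \<open>4 * k \<ge> 3 * k\<close>; being unblocked, it will cap the interface.\<close>
  obtain B1 where B1: "B1 \<in> events" "prob B1 \<le> 1 / 4"
    "\<And>\<omega>. \<omega> \<in> space M - B1 \<Longrightarrow> \<not> blocked (\<lambda>y. \<omega> \<in> E y) (3 * int k, int k)"
    by (rule prob_blocked[OF E probE q m, of "3 * int k" "int k"]) auto
  let ?G = "space M - (B0 \<union> B1)"
  show ?thesis
  proof (rule that)
    have "prob (B0 \<union> B1) \<le> 1 / 2"
      using measure_Un_le[OF B0(1) B1(1)] B0(2) B1(2) by simp
    moreover have "prob ?G = 1 - prob (B0 \<union> B1)"
      using B0 B1 by (intro prob_compl) auto
    ultimately show "1 / 2 \<le> prob ?G" by simp
    show "?G \<in> events" using B0 B1 by auto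
    fix \<omega> assume \<omega>: "\<omega> \<in> ?G"
    then have "\<not> blocked (\<lambda>y. \<omega> \<in> E y) (0, 0)"
      using B0(3) by auto
    then obtain g where g: "g 0 = 0" "\<And>n. g (Suc n) = g n \<or> g (Suc n) = g n + 1"
      "\<And>n. \<omega> \<notin> E (int n, g n)" "\<And>n. blocked (\<lambda>y. \<omega> \<in> E y) (int n, g n - 1)"
      by (rule open_path) blast
    have "?s (int (3 * k), g (3 * k)) \<in> awakened m S \<omega> (3 * k)"
    proof (rule awakened_path[where p = "\<lambda>n. ?s (int n, g n)"])
      show "?s (int 0, g 0) = 0"
        by (simp add: site_nth[OF ij] vec_eq_iff g(1))
      fix n
      let ?y = "?s (int n, g n)"
      have "?s (int (Suc n), g (Suc n)) = ?y + u \<or> ?s (int (Suc n), g (Suc n)) = ?y + v"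
        using g(2)[of n] ij by (auto simp: vec_eq_iff site_nth u_def v_def axis_def algebra_simps)
      moreover have "\<exists>i\<in>{1..m}. S ?y i 1 \<omega> = ?y + u" "\<exists>i\<in>{1..m}. S ?y i 1 \<omega> = ?y + v"
        using g(3)[of n] \<omega> by (auto simp: E_def missed_def)
      ultimately show "\<exists>i\<in>{1..m}. S ?y i 1 \<omega> = ?s (int (Suc n), g (Suc n))"
        by auto
    qed
    moreover have "0 \<le> g n" for n
    proof (induction n)
      case (Suc n)
      with g(2)[of n] show ?case by auto
    qed (simp add: g(1))
    moreover have "g (3 * k) \<le> int k"
    proof (rule ccontr)
      assume "\<not> g (3 * k) \<le> int k"
      \<comment> \<open>Otherwise \<open>g (3 * k) - 1 \<ge> k\<close> is a blocked height, and
        downward closure blocks \<open>(3 k, k)\<close>.\<close>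
      then have "blocked (\<lambda>y. \<omega> \<in> E y) (3 * int k, int k)"
        using g(4)[of "3 * k"] by (auto elim: blocked_antimono)
      with B1(3) \<omega> show False by auto
    qed
    ultimately show "\<exists>h. 0 \<le> h \<and> h \<le> int k \<and> ?s (3 * int k, h) \<in> awakened m S \<omega> (3 * k)"
      by auto
  qed
qed

section \<open>Passage to the asymptotic shape\<close>

text \<open>Awake sites rescaled by time \<open>3 * k\<close> lie on the segment of parameters
  between 0 and 1/3, and by the outer inclusion also in a slight enlargement of \<open>A\<close>.
  Compactness of \<open>A\<close> and closedness of the segment let the enlargement shrink to
  nothing.\<close>

lemma shape_contains_direction:
  fixes S :: "int ^ 'd \<Rightarrow> nat \<Rightarrow> nat \<Rightarrow> 'w \<Rightarrow> int ^ 'd"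
  assumes frog: "frog_walks m M S" and m: "2 * (1 - 1 / (2 * real CARD('d))) ^ m \<le> (1 / 15) ^ 5"
    and shape: "asymptotic_shape m M S A"
    and ij: "i \<noteq> j" and st: "s \<in> {1, -1}" "t \<in> {1, -1}"
  obtains b where "0 \<le> b" "b \<le> 1 / 3"
    "(real_of_int s * (1 - b)) *\<^sub>R axis i 1 + (real_of_int t * b) *\<^sub>R axis j 1 \<in> A"
proof -
  interpret prob_space M using frog by (simp add: frog_walks_def)
  define f where "f b = (real_of_int s * (1 - b)) *\<^sub>R axis i 1 + (real_of_int t * b) *\<^sub>R axis j (1 :: real)" for b
  have f_nth: "f b $ l = (if l = i then s * (1 - b) else if l = j then t * b else 0)" for b :: real and l
    using ij by (auto simp: f_def axis_def)
  have cl: "closed (f ` {0..1/3})"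
    unfolding f_def by (intro compact_imp_closed compact_continuous_image continuous_intros) auto
  have "\<exists>G. G \<in> events \<and> 1 / 2 \<le> prob G \<and> (\<forall>\<omega>\<in>G. \<exists>h. 0 \<le> h \<and> h \<le> int k \<and>
      site i j s t (3 * int k, h) \<in> awakened m S \<omega> (3 * k))" for k
    by (rule prob_awakened_site[OF frog m ij st, of k]) blast
  then obtain G where G: "\<And>k. G k \<in> events" "\<And>k. 1 / 2 \<le> prob (G k)"
    "\<And>k \<omega>. \<omega> \<in> G k \<Longrightarrow> \<exists>h. 0 \<le> h \<and> h \<le> int k \<and> site i j s t (3 * int k, h) \<in> awakened m S \<omega> (3 * k)"
    by metis
  have near: "\<exists>a\<in>A. (1 + e) *\<^sub>R a \<in> f ` {0..1/3}" if e: "0 < e" "e < 1" for e :: real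
  proof -
    let ?R = "\<lambda>\<omega> n. (\<lambda>y. y /\<^sub>R real n) ` awakened_region m S \<omega> n"
    let ?Q = "\<lambda>\<omega> n. ?R \<omega> n \<subseteq> (\<lambda>y. (1 + e) *\<^sub>R y) ` A"
    have "AE \<omega> in M. \<forall>\<^sub>F n in sequentially. (\<lambda>y. (1 - e) *\<^sub>R y) ` A \<subseteq> ?R \<omega> n \<and> ?Q \<omega> n"
      using shape e unfolding asymptotic_shape_def by blast
    \<comment> \<open>The inclusion is restricted to times divisible by 3, at which the awake sites
      are known.\<close>
    then have "AE \<omega> in M. \<forall>\<^sub>F k in sequentially. ?Q \<omega> (3 * k)"
    proof eventually_elim
      case (elim \<omega>)
      have "filterlim (\<lambda>k::nat. 3 * k) sequentially sequentially"
        by (rule filterlim_subseq) (auto simp: strict_mono_def)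
      from eventually_compose_filterlim[OF elim this] show ?case
        by (rule eventually_mono) auto
    qed
    then obtain k \<omega> where k: "k > 0" "\<omega> \<in> G k" "?Q \<omega> (3 * k)"
      using frequently_AE[of G "1 / 2" "\<lambda>\<omega> k. ?Q \<omega> (3 * k)"] G(1,2) by auto
    then obtain h where h: "0 \<le> h" "h \<le> int k" "site i j s t (3 * int k, h) \<in> awakened m S \<omega> (3 * k)"
      using G(3) by blast
    let ?y = "(\<chi> l. real_of_int (site i j s t (3 * int k, h) $ l)) :: real ^ 'd"
    have "?y \<in> awakened_region m S \<omega> (3 * k)"
      unfolding awakened_region_def unit_cell_def using h(3) by (intro UN_I) auto
    then obtain a where a: "a \<in> A" "?y /\<^sub>R real (3 * k) = (1 + e) *\<^sub>R a"
      using k(3) by blast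
    moreover have "?y /\<^sub>R real (3 * k) = f (h / (3 * k))"
      using ij k(1) by (auto simp: vec_eq_iff f_nth site_nth field_simps)
    moreover have "h / (3 * k) \<in> {0..1/3}"
      using h(1,2) k(1) by (auto simp: field_simps)
    ultimately show ?thesis by (metis imageI)
  qed
  \<comment> \<open>The choice \<open>e = 1 / (n + 2)\<close> lies strictly between 0 and 1 for
    every \<open>n\<close>, including 0.\<close>
  have "\<exists>a\<in>A. (1 + 1 / (real n + 2)) *\<^sub>R a \<in> f ` {0..1/3}" for n
    by (rule near) auto
  then obtain a where a: "\<And>n. a n \<in> A" "\<And>n. (1 + 1 / (real n + 2)) *\<^sub>R a n \<in> f ` {0..1/3}"
    by metis
  have "compact A"
    using shape by (simp add: asymptotic_shape_def)
  then obtain l r where l: "l \<in> A" "strict_mono r" "(a \<circ> r) \<longlonglongrightarrow> l"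
    using a(1) unfolding compact_def by metis
  have "(\<lambda>n. 1 + 1 / (real n + 2)) \<longlonglongrightarrow> 1 + 0"
    by (intro tendsto_intros) real_asymp
  from LIMSEQ_subseq_LIMSEQ[OF this l(2)]
  have "(\<lambda>n. (1 + 1 / (real (r n) + 2)) *\<^sub>R a (r n)) \<longlonglongrightarrow> 1 *\<^sub>R l"
    using l(3) by (intro tendsto_scaleR) (auto simp: o_def)
  then have "l \<in> f ` {0..1/3}"
    using closed_sequentially[OF cl, of "\<lambda>n. (1 + 1 / (real (r n) + 2)) *\<^sub>R a (r n)" l] a(2) by simp
  then show ?thesis
    using l(1) that by (auto simp: f_def)
qed

text \<open>One point of \<open>A\<close> on the edge has parameter at most 1/3 and, after
  exchanging the axes, another has parameter at least 2/3. Every point of the edge with parameter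
  between 1/3 and 2/3 is a convex combination of the two.\<close>

lemma Theta_plane_subset_shape:
  fixes S :: "int ^ 'd \<Rightarrow> nat \<Rightarrow> nat \<Rightarrow> 'w \<Rightarrow> int ^ 'd"
  assumes frog: "frog_walks m M S" and m: "2 * (1 - 1 / (2 * real CARD('d))) ^ m \<le> (1 / 15) ^ 5"
    and shape: "asymptotic_shape m M S A" and ij: "i \<noteq> j"
  shows "Theta_plane (1 / 3) i j \<subseteq> A"
proof
  fix x :: "real ^ 'd" assume "x \<in> Theta_plane (1 / 3) i j"
  then have x: "\<And>k. k \<noteq> i \<Longrightarrow> k \<noteq> j \<Longrightarrow> x $ k = 0" "\<bar>x $ i\<bar> + \<bar>x $ j\<bar> = 1"
    "\<bar>x $ i\<bar> \<ge> 1 / 3" "\<bar>x $ j\<bar> \<ge> 1 / 3"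
    by (auto simp: Theta_plane_def coord_plane_def)
  \<comment> \<open>Both coordinates have modulus at least 1/3, so the \<open>else\<close> branches
    mean negative, never zero.\<close>
  define s t :: int where "s = (if x $ i > 0 then 1 else -1)" and "t = (if x $ j > 0 then 1 else -1)"
  have st: "s \<in> {1, -1}" "t \<in> {1, -1}"
    by (auto simp: s_def t_def)
  define c where "c = \<bar>x $ j\<bar>"
  have xc: "x $ i = s * (1 - c)" "x $ j = t * c" "1 / 3 \<le> c" "c \<le> 2 / 3"
    using x by (auto simp: s_def t_def c_def)
  define f where "f b = (real_of_int s * (1 - b)) *\<^sub>R axis i 1 + (real_of_int t * b) *\<^sub>R axis j (1 :: real)" for b
  obtain b where b: "0 \<le> b" "b \<le> 1 / 3" "f b \<in> A"
    unfolding f_def using shape_contains_direction[OF frog m shape ij st] .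
  obtain b' where b': "0 \<le> b'" "b' \<le> 1 / 3"
    "(real_of_int t * (1 - b')) *\<^sub>R axis j 1 + (real_of_int s * b') *\<^sub>R axis i 1 \<in> A"
    using shape_contains_direction[OF frog m shape ij[symmetric] st(2,1)] .
  have fb': "f (1 - b') \<in> A"
    using b'(3) by (simp add: f_def add.commute)
  \<comment> \<open>The denominator is at least 1/3, because \<open>b\<close> and \<open>b'\<close>
    are at most 1/3.\<close>
  define \<theta> where "\<theta> = (c - b) / (1 - b' - b)"
  have \<theta>: "0 \<le> \<theta>" "\<theta> \<le> 1"
    using b b' xc by (auto simp: \<theta>_def field_simps)
  have c: "c = (1 - \<theta>) * b + \<theta> * (1 - b')"
  proof -
    have "\<theta> * (1 - b' - b) = c - b"
      using b b' by (simp add: \<theta>_def)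
    then show ?thesis by (simp add: algebra_simps)
  qed
  have "x = f c"
    using x(1) xc(1,2) ij by (auto simp: vec_eq_iff f_def axis_def)
  also have "\<dots> = (1 - \<theta>) *\<^sub>R f b + \<theta> *\<^sub>R f (1 - b')"
    by (simp add: c f_def vec_eq_iff algebra_simps)
  also have "\<dots> \<in> A"
    using shape \<theta> b(3) fb' by (intro convexD) (auto simp: asymptotic_shape_def)
  finally show "x \<in> A" .
qed

theorem theorem1p2:
  "\<forall>\<^sub>F m in sequentially. \<exists>\<beta>::real. 0 < \<beta> \<and> \<beta> < 1 / 2 \<and>
     (\<forall>(M :: 'w measure) (S :: int ^ 'd \<Rightarrow> nat \<Rightarrow> nat \<Rightarrow> 'w \<Rightarrow> int ^ 'd) (A :: (real ^ 'd) set).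
        frog_walks m M S \<longrightarrow> asymptotic_shape m M S A \<longrightarrow> Theta \<beta> \<subseteq> A)"
proof -
  let ?\<rho> = "1 - 1 / (2 * real CARD('d))"
  have "\<bar>?\<rho>\<bar> < 1"
    using miss_prob_bounds[where 'd = 'd] by linarith
  then have "(\<lambda>m. 2 * ?\<rho> ^ m) \<longlonglongrightarrow> 2 * 0"
    by (intro tendsto_intros LIMSEQ_power_zero) auto
  then have "\<forall>\<^sub>F m in sequentially. 2 * ?\<rho> ^ m < (1 / 15) ^ 5"
    by (rule order_tendstoD) simp
  then show ?thesis
  proof eventually_elim
    case (elim m)
    show ?case
    \<comment> \<open>The same \<open>\<beta> = 1 / 3\<close> serves every large \<open>m\<close>;
      only the threshold for \<open>m\<close> depends on the dimension.\<close>
    proof (intro exI[of _ "1 / 3"] conjI allI impI)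
      fix M :: "'w measure" and S :: "int ^ 'd \<Rightarrow> nat \<Rightarrow> nat \<Rightarrow> 'w \<Rightarrow> int ^ 'd" and A
      assume *: "frog_walks m M S" "asymptotic_shape m M S A"
      then have "convex A" by (simp add: asymptotic_shape_def)
      moreover have "Theta_plane (1 / 3) i j \<subseteq> A" if "i \<noteq> j" for i j
        using Theta_plane_subset_shape[OF *(1) _ *(2) that] elim by simp
      \<comment> \<open>Convexity of \<open>A\<close> reduces the hull to its generators; in
        dimension 1 there are none and the hull is empty.\<close>
      ultimately show "Theta (1 / 3) \<subseteq> A"
        unfolding Theta_def by (intro hull_minimal) blast+
    qed auto
  qed
qed

end
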